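(* For all integers $n\ge 0$ and $m\ge 1$, $$\sum_{0\le k\le n}B_{km}=\frac{B_{m(n+1)}-B_{mn}-B_m}{-2+6B_m-2B_{m-1}}.$$
   Context: The balancing numbers $(B_n)_{n\ge 0}$ are defined by $B_0=0$, $B_1=1$ and $B_n=6B_{n-1}-B_{n-2}$ for $n\ge 2$. The identity is between rational numbers. *)

theory Defs
  imports Complex_Main
begin

fun balancing :: "nat \<Rightarrow> int" where
  "balancing 0 = 0"
| "balancing (Suc 0) = 1"
| "balancing (Suc (Suc n)) = 6 * balancing (Suc n) - balancing n"

end

theory Submission
  imports Defs
begin

text \<open>
  Write \<open>B n\<close> for the \<open>n\<close>-th balancing number. The recurrence \<open>B (n + 2) = 6 B (n + 1) - B n\<close> has
  the characteristic roots \<open>r\<close> and \<open>1 / r\<close>, where \<open>r = 3 + 2 \<surd>2\<close>. Hence every \<open>m\<close>-th term again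
  satisfies a recurrence of order two, with \<open>6 = r + 1 / r\<close> replaced by the trace
  \<open>t = r\<^sup>m + 1 / r\<^sup>m\<close>, which is an integer combination of neighbouring balancing numbers
  (\<open>balancing_add_diff\<close>). Written with \<open>b k = B (k m)\<close> as
  \<open>(t - 2) b (k + 1) = (b (k + 2) - b (k + 1)) - (b (k + 1) - b k)\<close>,
  this recurrence makes \<open>t - 2\<close> times the sum telescope (\<open>balancing_multiples_sum\<close>). The factor
  \<open>t - 2\<close> is the denominator of the claim; it is positive because the balancing numbers increase.
\<close>

text \<open>
  The factor \<open>2 B (m + 1) - 6 B m\<close> is the trace \<open>r\<^sup>m + 1 / r\<^sup>m\<close>, in a form that makes sense also
  at \<open>m = 0\<close>. For fixed \<open>a\<close>, both sides satisfy the balancing recurrence in \<open>m\<close>, because that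
  recurrence is unchanged by reversing the direction of the sequence; so they agree once they agree
  at \<open>m = 0\<close> and \<open>m = 1\<close>.
\<close>
lemma balancing_add_diff:
  assumes "m \<le> a"
  shows "balancing (a + m) + balancing (a - m) =
    (2 * balancing (Suc m) - 6 * balancing m) * balancing a"
  using assms
proof (induction m rule: balancing.induct)
  case 1
  show ?case by simp
next
  case 2
  then obtain b where "a = Suc b"
    by (cases a) auto
  then show ?case by simp
next
  case (3 m)
  then obtain b where a: "a = Suc (Suc (b + m))"
    by (metis add.commute add_Suc_right le_Suc_ex)
  have "balancing (a + Suc m) + balancing (a - Suc m) =
      (2 * balancing (Suc (Suc m)) - 6 * balancing (Suc m)) * balancing a"
    and "balancing (a + m) + balancing (a - m) =
      (2 * balancing (Suc m) - 6 * balancing m) * balancing a"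
    using 3 by simp_all
  moreover have "a - m = Suc (Suc b)" "a - Suc m = Suc b" "a - Suc (Suc m) = b"
    using a by simp_all
  ultimately show ?case
    by (simp add: algebra_simps)
qed

lemma balancing_multiples_recurrence:
  "balancing (Suc p * (k + 2)) + balancing (Suc p * k) =
    (6 * balancing (Suc p) - 2 * balancing p) * balancing (Suc p * (k + 1))"
  using balancing_add_diff[of "Suc p" "Suc p * (k + 1)"]
  by (simp add: algebra_simps)

lemma balancing_strict_increasing:
  "0 \<le> balancing n \<and> balancing n < balancing (Suc n)"
  by (induction n) auto

lemma balancing_multiples_sum:
  "(6 * balancing (Suc p) - 2 * balancing p - 2) * (\<Sum>k\<le>n. balancing (k * Suc p)) =
    balancing (Suc p * (n + 1)) - balancing (Suc p * n) - balancing (Suc p)"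
proof (induction n)
  case 0
  show ?case by simp
next
  case (Suc n)
  let ?t = "6 * balancing (Suc p) - 2 * balancing p"
  have "(?t - 2) * (\<Sum>k\<le>Suc n. balancing (k * Suc p)) =
      (?t - 2) * (\<Sum>k\<le>n. balancing (k * Suc p)) + (?t - 2) * balancing (Suc p * (n + 1))"
    by (subst sum.atMost_Suc)
      (simp only: distrib_left[where 'a = int] mult.commute[of "n + 1" "Suc p"] Suc_eq_plus1[of n])
  also have "\<dots> = (balancing (Suc p * (n + 1)) - balancing (Suc p * n) - balancing (Suc p))
      + (?t * balancing (Suc p * (n + 1)) - 2 * balancing (Suc p * (n + 1)))"
    unfolding Suc.IH by (simp only: left_diff_distrib)
  also have "\<dots> = balancing (Suc p * (n + 2)) - balancing (Suc p * (n + 1)) - balancing (Suc p)"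
    unfolding balancing_multiples_recurrence[symmetric] by simp
  finally show ?case by simp
qed

theorem theorem3:
  fixes n m :: nat
  assumes "m \<ge> 1"
  shows "(\<Sum>k\<le>n. (of_int (balancing (k * m)) :: rat)) =
    (of_int (balancing (m * (n + 1))) - of_int (balancing (m * n)) - of_int (balancing m)) /
    (- 2 + 6 * of_int (balancing m) - 2 * of_int (balancing (m - 1)))"
proof -
  obtain p where m: "m = Suc p"
    using assms by (cases m) auto
  let ?d = "6 * balancing m - 2 * balancing p - 2"
  let ?S = "\<Sum>k\<le>n. balancing (k * m)"
  have "?d > 0"
    using balancing_strict_increasing[of p] unfolding m by linarith
  then have "(of_int ?d :: rat) \<noteq> 0"
    by linarith
  moreover have "(of_int (?d * ?S) :: rat) =
      of_int (balancing (m * (n + 1)) - balancing (m * n) - balancing m)"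
    unfolding m balancing_multiples_sum ..
  then have "(of_int ?S :: rat) * of_int ?d =
      of_int (balancing (m * (n + 1)) - balancing (m * n) - balancing m)"
    by (simp only: of_int_mult mult.commute)
  ultimately have "(of_int ?S :: rat) =
      of_int (balancing (m * (n + 1)) - balancing (m * n) - balancing m) / of_int ?d"
    by (simp only: nonzero_eq_divide_eq not_False_eq_True)
  moreover have "(of_int ?d :: rat) =
      - 2 + 6 * of_int (balancing m) - 2 * of_int (balancing (m - 1))"
    using m by simp
  ultimately show ?thesis
    by (simp only: of_int_sum of_int_diff)
qed

end
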